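(* Let $G$ have a RAAG-like action on the CAT(0) cube complex $X$, let $g\in G$ be hyperbolic and $o$ a vertex with $d^c(o,go)=\delta(g)$. Let $\gamma$ be a maximal $g$-nested segment in $[o,go]$, let $\phi_\gamma:G\to\mathbb R$, $\phi_\gamma(h)=\omega_\gamma(o,ho)$, and let $\overline\phi_\gamma(h)=\lim_{n\to\infty}\phi_\gamma(h^n)/n$ be its homogenisation. Then $\overline{\phi}_{\gamma}(g)\ge 1$.
   Context: $\mathcal{H}(X)$ is the set of halfspaces, $\overline\Phi$ the complement of $\Phi$. Two halfspaces are nested if one of $\Phi\subseteq\Psi$, $\overline{\Phi}\subseteq\Psi$, $\Phi\subseteq\overline{\Psi}$, $\overline{\Phi}\subseteq\overline{\Psi}$ holds, transverse otherwise; tightly nested means nested with no halfspace strictly in between for the relevant strict inclusion; $\Phi\supsetneq\Psi$ tightly means $\Phi\supsetneq\Psi$ and no $\Phi'$ has $\Phi\supsetneq\Phi'\supsetneq\Psi$. The action is RAAG-like if: (i) no $\Phi$, $h\in G$ with $h\overline\Phi=\Phi$; (ii) no $\Phi$, $h$ with $\Phi$, $h\Phi$ transverse; (iii) no tightly nested $\Phi,\Phi'$ and $h$ with $\Phi$, $h\Phi'$ transverse; (iv) no $\Phi$, $h$ with $\Phi\subsetneq h\overline\Phi$ tightly. $d^c$ is the combinatorial distance on vertices, $\delta(g)=\min_x d^c(x,gx)$, $g$ hyperbolic if $\delta(g)>0$. For vertices $x,y$, $[x,y]=\{\Phi: x\notin\Phi,\ y\in\Phi\}$. A segment is a finite sequence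 $\gamma=(\Phi_0,\dots,\Phi_r)$ of halfspaces with $\Phi_i\supsetneq\Phi_{i+1}$ tightly; its reverse is $\overline\gamma=(\overline\Phi_r,\dots,\overline\Phi_0)$; copies of $\gamma$ are $h\gamma=(h\Phi_0,\dots,h\Phi_r)$, $h\in G$. Two segments overlap if some halfspace of one is equal or transverse to some halfspace of the other. A segment is in $[x,y]$ if all its halfspaces lie in $[x,y]$. $c_\gamma(x,y)$ is the largest cardinality of a set of pairwise non-overlapping copies of $\gamma$ in $[x,y]$, and $\omega_\gamma(x,y)=c_\gamma(x,y)-c_{\overline\gamma}(x,y)$. For segments $\gamma=(\Phi_0,\dots,\Phi_r)$, $\gamma'=(\Psi_0,\dots,\Psi_s)$ write $\gamma>\gamma'$ if $\Phi_r\supsetneq\Psi_0$. A segment $\gamma$ in $[o,go]$ is $g$-nested if $\gamma>g\gamma$; it is maximal $g$-nested if no other $g$-nested segment in $[o,go]$ contains (all halfspaces of) $\gamma$. *)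

theory Defs
  imports Complex_Main "HOL-Algebra.Group"
begin

text \<open>The vertex set of the cube complex is the type 'v; its 1-skeleton is given by
  the adjacency relation adj. A graph is the 1-skeleton of a CAT(0) cube complex iff it
  is a median graph (Chepoi, Roller, Gerasimov).\<close>

definition edge_rel :: "('v \<Rightarrow> 'v \<Rightarrow> bool) \<Rightarrow> ('v \<times> 'v) set" where
  "edge_rel adj = {(x, y). adj x y}"

definition dc :: "('v \<Rightarrow> 'v \<Rightarrow> bool) \<Rightarrow> 'v \<Rightarrow> 'v \<Rightarrow> nat" where
  "dc adj x y = (LEAST n. (x, y) \<in> edge_rel adj ^^ n)"

definition interval :: "('v \<Rightarrow> 'v \<Rightarrow> bool) \<Rightarrow> 'v \<Rightarrow> 'v \<Rightarrow> 'v set" where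
  "interval adj x y = {m. dc adj x m + dc adj m y = dc adj x y}"

definition median_graph :: "('v \<Rightarrow> 'v \<Rightarrow> bool) \<Rightarrow> bool" where
  "median_graph adj \<longleftrightarrow>
     (\<forall>x y. adj x y \<longrightarrow> adj y x) \<and> (\<forall>x. \<not> adj x x) \<and>
     (\<forall>x y. \<exists>n. (x, y) \<in> edge_rel adj ^^ n) \<and>
     (\<forall>x y z. \<exists>!m. m \<in> interval adj x y \<and> m \<in> interval adj y z \<and> m \<in> interval adj x z)"

text \<open>Halfspaces: for an (oriented) edge (a,b), the set of vertices closer to b than to a,
  i.e. the side of the hyperplane dual to the edge containing b.\<close>
definition halfspaces :: "('v \<Rightarrow> 'v \<Rightarrow> bool) \<Rightarrow> 'v set set" where
  "halfspaces adj = {{x. dc adj x b < dc adj x a} | a b. adj a b}"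

definition nested :: "'v set \<Rightarrow> 'v set \<Rightarrow> bool" where
  "nested A B \<longleftrightarrow> A \<subseteq> B \<or> - A \<subseteq> B \<or> A \<subseteq> - B \<or> - A \<subseteq> - B"

definition transverse :: "'v set \<Rightarrow> 'v set \<Rightarrow> bool" where
  "transverse A B \<longleftrightarrow> \<not> nested A B"

definition tight_sup :: "'v set set \<Rightarrow> 'v set \<Rightarrow> 'v set \<Rightarrow> bool" where
  "tight_sup H A B \<longleftrightarrow> B \<subset> A \<and> \<not> (\<exists>C\<in>H. B \<subset> C \<and> C \<subset> A)"

definition tightly_nested :: "'v set set \<Rightarrow> 'v set \<Rightarrow> 'v set \<Rightarrow> bool" where
  "tightly_nested H A B \<longleftrightarrow>
     (\<exists>A'\<in>{A, - A}. \<exists>B'\<in>{B, - B}. tight_sup H B' A' \<or> tight_sup H A' B')"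

definition cube_action :: "('g, 'm) monoid_scheme \<Rightarrow> ('v \<Rightarrow> 'v \<Rightarrow> bool) \<Rightarrow> ('g \<Rightarrow> 'v \<Rightarrow> 'v) \<Rightarrow> bool" where
  "cube_action G adj act \<longleftrightarrow> group G \<and>
     (\<forall>h\<in>carrier G. bij (act h) \<and> (\<forall>x y. adj (act h x) (act h y) \<longleftrightarrow> adj x y)) \<and>
     act \<one>\<^bsub>G\<^esub> = id \<and>
     (\<forall>a\<in>carrier G. \<forall>b\<in>carrier G. act (a \<otimes>\<^bsub>G\<^esub> b) = act a \<circ> act b)"

definition raag_like :: "('g, 'm) monoid_scheme \<Rightarrow> ('v \<Rightarrow> 'v \<Rightarrow> bool) \<Rightarrow> ('g \<Rightarrow> 'v \<Rightarrow> 'v) \<Rightarrow> bool" where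
  "raag_like G adj act \<longleftrightarrow>
     (let H = halfspaces adj in
      (\<forall>P\<in>H. \<forall>h\<in>carrier G. act h ` (- P) \<noteq> P) \<and>
      (\<forall>P\<in>H. \<forall>h\<in>carrier G. \<not> transverse P (act h ` P)) \<and>
      (\<forall>P\<in>H. \<forall>P'\<in>H. \<forall>h\<in>carrier G. tightly_nested H P P' \<longrightarrow> \<not> transverse P (act h ` P')) \<and>
      (\<forall>P\<in>H. \<forall>h\<in>carrier G. \<not> tight_sup H (act h ` (- P)) P))"

definition translation_length :: "('v \<Rightarrow> 'v \<Rightarrow> bool) \<Rightarrow> ('g \<Rightarrow> 'v \<Rightarrow> 'v) \<Rightarrow> 'g \<Rightarrow> nat" where
  "translation_length adj act g = (LEAST n. \<exists>x. dc adj x (act g x) = n)"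

definition hyperbolic :: "('v \<Rightarrow> 'v \<Rightarrow> bool) \<Rightarrow> ('g \<Rightarrow> 'v \<Rightarrow> 'v) \<Rightarrow> 'g \<Rightarrow> bool" where
  "hyperbolic adj act g \<longleftrightarrow> translation_length adj act g > 0"

definition hs_between :: "('v \<Rightarrow> 'v \<Rightarrow> bool) \<Rightarrow> 'v \<Rightarrow> 'v \<Rightarrow> 'v set set" where
  "hs_between adj x y = {P \<in> halfspaces adj. x \<notin> P \<and> y \<in> P}"

definition segment :: "('v \<Rightarrow> 'v \<Rightarrow> bool) \<Rightarrow> 'v set list \<Rightarrow> bool" where
  "segment adj \<gamma> \<longleftrightarrow> \<gamma> \<noteq> [] \<and> set \<gamma> \<subseteq> halfspaces adj \<and>
     (\<forall>i. Suc i < length \<gamma> \<longrightarrow> tight_sup (halfspaces adj) (\<gamma> ! i) (\<gamma> ! Suc i))"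

definition seg_reverse :: "'v set list \<Rightarrow> 'v set list" where
  "seg_reverse \<gamma> = rev (map uminus \<gamma>)"

definition seg_copy :: "('g \<Rightarrow> 'v \<Rightarrow> 'v) \<Rightarrow> 'g \<Rightarrow> 'v set list \<Rightarrow> 'v set list" where
  "seg_copy act h \<gamma> = map (\<lambda>P. act h ` P) \<gamma>"

definition overlap :: "'v set list \<Rightarrow> 'v set list \<Rightarrow> bool" where
  "overlap \<gamma> \<gamma>' \<longleftrightarrow> (\<exists>A\<in>set \<gamma>. \<exists>B\<in>set \<gamma>'. A = B \<or> transverse A B)"

definition seg_in :: "('v \<Rightarrow> 'v \<Rightarrow> bool) \<Rightarrow> 'v set list \<Rightarrow> 'v \<Rightarrow> 'v \<Rightarrow> bool" where
  "seg_in adj \<gamma> x y \<longleftrightarrow> set \<gamma> \<subseteq> hs_between adj x y"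

definition seg_count :: "('g, 'm) monoid_scheme \<Rightarrow> ('v \<Rightarrow> 'v \<Rightarrow> bool) \<Rightarrow> ('g \<Rightarrow> 'v \<Rightarrow> 'v)
    \<Rightarrow> 'v set list \<Rightarrow> 'v \<Rightarrow> 'v \<Rightarrow> nat" where
  "seg_count G adj act \<gamma> x y = Max {card S | S. finite S \<and>
      S \<subseteq> {seg_copy act h \<gamma> | h. h \<in> carrier G} \<and>
      (\<forall>\<sigma>\<in>S. seg_in adj \<sigma> x y) \<and>
      (\<forall>\<sigma>\<in>S. \<forall>\<tau>\<in>S. \<sigma> \<noteq> \<tau> \<longrightarrow> \<not> overlap \<sigma> \<tau>)}"

definition omega :: "('g, 'm) monoid_scheme \<Rightarrow> ('v \<Rightarrow> 'v \<Rightarrow> bool) \<Rightarrow> ('g \<Rightarrow> 'v \<Rightarrow> 'v)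
    \<Rightarrow> 'v set list \<Rightarrow> 'v \<Rightarrow> 'v \<Rightarrow> int" where
  "omega G adj act \<gamma> x y = int (seg_count G adj act \<gamma> x y) - int (seg_count G adj act (seg_reverse \<gamma>) x y)"

definition seg_gt :: "'v set list \<Rightarrow> 'v set list \<Rightarrow> bool" where
  "seg_gt \<gamma> \<gamma>' \<longleftrightarrow> hd \<gamma>' \<subset> last \<gamma>"

definition g_nested :: "('v \<Rightarrow> 'v \<Rightarrow> bool) \<Rightarrow> ('g \<Rightarrow> 'v \<Rightarrow> 'v) \<Rightarrow> 'g \<Rightarrow> 'v \<Rightarrow> 'v set list \<Rightarrow> bool" where
  "g_nested adj act g b \<gamma> \<longleftrightarrow> segment adj \<gamma> \<and> seg_in adj \<gamma> b (act g b) \<and> seg_gt \<gamma> (seg_copy act g \<gamma>)"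

definition max_g_nested :: "('v \<Rightarrow> 'v \<Rightarrow> bool) \<Rightarrow> ('g \<Rightarrow> 'v \<Rightarrow> 'v) \<Rightarrow> 'g \<Rightarrow> 'v \<Rightarrow> 'v set list \<Rightarrow> bool" where
  "max_g_nested adj act g b \<gamma> \<longleftrightarrow> g_nested adj act g b \<gamma> \<and>
     (\<forall>\<gamma>'. g_nested adj act g b \<gamma>' \<and> set \<gamma> \<subseteq> set \<gamma>' \<longrightarrow> \<gamma>' = \<gamma>)"

end

theory Submission
  imports Defs
begin

text \<open>Since \<open>b\<close> has minimal displacement and \<open>g\<close> inverts no hyperplane, a halfspace \<open>P\<close> entered between
  \<open>b\<close> and \<open>g b\<close> is not left between \<open>g b\<close> and \<open>g\<^sup>2 b\<close>; as \<open>P\<close> and \<open>g P\<close> are nested this gives \<open>g P \<subset> P\<close>, so the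
  orbit of \<open>b\<close> crosses each hyperplane at most once. Non-overlapping copies of a segment between two
  vertices form a chain, so cutting at a point of the orbit changes the count by at most one, and the
  homogenisation exists; the copies \<open>g\<^sup>k \<gamma>\<close> show that the count up to \<open>g\<^sup>n b\<close> is at least \<open>n\<close>. Finally, no copy
  of the reverse of \<open>\<gamma>\<close> occurs along the orbit: its halfspaces are nested with the corresponding and the
  neighbouring ones of \<open>g\<^sup>k \<gamma>\<close>, which forces it into the gap between \<open>g\<^sup>k \<gamma>\<close> and \<open>g\<^sup>k\<^sup>+\<^sup>1 \<gamma>\<close> for some \<open>k\<close>, and
  this contradicts the maximality of \<open>\<gamma>\<close>.\<close>

section \<open>Halfspaces of median graphs\<close>

locale median =
  fixes adj :: "'v \<Rightarrow> 'v \<Rightarrow> bool"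
  assumes med: "median_graph adj"
begin

abbreviation "d \<equiv> dc adj"
abbreviation "H \<equiv> halfspaces adj"

definition W :: "'v \<Rightarrow> 'v \<Rightarrow> 'v set" where
  "W x y = {v. d v y < d v x}"

section \<open>Graph distance, medians and bipartiteness\<close>

lemma adj_sym: "adj x y \<Longrightarrow> adj y x"
  using med by (auto simp: median_graph_def)

lemma adj_irrefl: "\<not> adj x x"
  using med by (auto simp: median_graph_def)

lemma walk_dc: "(x, y) \<in> edge_rel adj ^^ d x y"
proof -
  have "\<exists>n. (x, y) \<in> edge_rel adj ^^ n"
    using med by (auto simp: median_graph_def)
  then show ?thesis
    unfolding dc_def by (rule LeastI_ex)
qed

lemma dc_le_walk: "(x, y) \<in> edge_rel adj ^^ n \<Longrightarrow> d x y \<le> n"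
  unfolding dc_def by (rule Least_le)

lemma dc_refl [simp]: "d x x = 0"
  using dc_le_walk[of x x 0] by simp

lemma dc_eq_0 [simp]: "d x y = 0 \<longleftrightarrow> x = y"
  using walk_dc[of x y] by auto

lemma dc_triangle: "d x z \<le> d x y + d y z"
  by (rule dc_le_walk) (auto simp: relpow_add intro: walk_dc)

lemma dc_sym: "d x y = d y x"
proof -
  have sym: "(edge_rel adj)\<inverse> = edge_rel adj"
    by (auto simp: edge_rel_def intro: adj_sym)
  have "(y, x) \<in> edge_rel adj ^^ n" if "(x, y) \<in> edge_rel adj ^^ n" for x y n
    using that
  proof (induction n arbitrary: y)
    case (Suc n)
    then obtain z where "(x, z) \<in> edge_rel adj ^^ n" "(z, y) \<in> edge_rel adj"
      by auto
    with Suc.IH sym show ?case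
      by (metis converse_iff relpow_Suc_I2)
  qed auto
  then have "d y x \<le> d x y" for x y
    by (meson dc_le_walk walk_dc)
  then show ?thesis
    by (simp add: antisym)
qed

lemma dc_adj: "adj x y \<Longrightarrow> d x y = 1"
proof -
  assume a: "adj x y"
  then have "d x y \<le> 1"
    by (intro dc_le_walk) (auto simp: edge_rel_def)
  moreover have "d x y \<noteq> 0"
    using a adj_irrefl by auto
  ultimately show ?thesis by linarith
qed

lemma adj_iff_dc: "adj x y \<longleftrightarrow> d x y = 1"
proof
  assume "d x y = 1"
  with walk_dc[of x y] show "adj x y" by (simp add: edge_rel_def)
qed (rule dc_adj)

lemma closer_neighbour:
  assumes "x \<noteq> y"
  obtains z where "adj x z" "d x y = Suc (d z y)"
proof -
  obtain n where n: "d x y = Suc n"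
    using assms by (metis dc_eq_0 not0_implies_Suc)
  then obtain z where z: "(x, z) \<in> edge_rel adj" "(z, y) \<in> edge_rel adj ^^ n"
    using walk_dc[of x y] relpow_Suc_D2 by metis
  then have "adj x z" "d z y \<le> n"
    by (auto simp: edge_rel_def dc_le_walk)
  moreover have "d x y \<le> 1 + d z y"
    using dc_triangle[of x y z] \<open>adj x z\<close> by (simp add: dc_adj)
  ultimately show ?thesis
    using n that by force
qed

lemma median_exists:
  obtains m where "d x m + d m y = d x y" "d y m + d m z = d y z" "d x m + d m z = d x z"
  using med unfolding median_graph_def interval_def by blast

lemma median_unique:
  assumes "d x m + d m y = d x y" "d y m + d m z = d y z" "d x m + d m z = d x z"
    and "d x m' + d m' y = d x y" "d y m' + d m' z = d y z" "d x m' + d m' z = d x z"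
  shows "m = m'"
  using med assms unfolding median_graph_def interval_def by blast

text \<open>The median of \<open>x\<close>, \<open>y\<close> and \<open>v\<close> lies on the edge,
  so it is one of its ends, and that end lies on a geodesic from the other end to
  \<open>v\<close>.\<close>

lemma bipartite:
  assumes "adj x y"
  shows "d v x = Suc (d v y) \<or> d v y = Suc (d v x)"
proof -
  obtain m where m: "d x m + d m y = d x y" "d y m + d m v = d y v" "d x m + d m v = d x v"
    by (rule median_exists)
  have 1: "d x y = 1" by (simp add: assms dc_adj)
  then consider "d x m = 0" | "d m y = 0" using m by linarith
  then show ?thesis
    by cases (use m 1 in \<open>auto simp: dc_sym\<close>)
qed

lemma dc_W_iff: "adj x y \<Longrightarrow> v \<in> W x y \<longleftrightarrow> d v x = Suc (d v y)"
  using bipartite[of x y v] by (auto simp: W_def)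

lemma dc_not_W_iff: "adj x y \<Longrightarrow> v \<notin> W x y \<longleftrightarrow> d v y = Suc (d v x)"
  using bipartite[of x y v] by (auto simp: W_def)

lemma W_compl: "adj x y \<Longrightarrow> - W x y = W y x"
  using dc_W_iff[of x y] dc_not_W_iff[of y x] adj_sym[of x y] by (force simp: dc_not_W_iff dc_W_iff)

section \<open>Edges dual to a common hyperplane, finiteness and convexity\<close>

lemma halfspaces_W: "H = {W x y |x y. adj x y}"
  by (simp add: halfspaces_def W_def)

lemma halfspace_compl: "P \<in> H \<Longrightarrow> - P \<in> H"
  unfolding halfspaces_W using W_compl adj_sym by blast

text \<open>If \<open>x\<close> violated the inclusion, the opposite corners \<open>c\<close> and
  \<open>e'\<close> of the 4-cycle would be equally far from \<open>x\<close> and closer than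
  \<open>c'\<close> and \<open>e\<close>. Both would then be medians of \<open>c'\<close>,
  \<open>e\<close> and \<open>x\<close>.\<close>

lemma W_square_subset:
  assumes "adj c e" "adj c' e'" "adj c c'" "adj e e'" "c \<noteq> e'" "c' \<noteq> e"
  shows "W c' e' \<subseteq> W c e"
proof
  fix x assume x: "x \<in> W c' e'"
  show "x \<in> W c e"
  proof (rule ccontr)
    assume "x \<notin> W c e"
    then have 1: "d x e = Suc (d x c)"
      using assms by (simp add: dc_not_W_iff)
    have 2: "d x c' = Suc (d x e')"
      using assms x by (simp add: dc_W_iff)
    have 3: "d x c = d x e'"
      using 1 2 bipartite[OF assms(3), of x] bipartite[OF assms(4), of x] by linarith
    have 4: "d c' e = 2"
      using bipartite[OF assms(1), of c'] dc_adj[OF adj_sym[OF assms(3)]] assms(6) by auto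
    have "d c c' = 1" "d c' c = 1" "d c e = 1" "d e c = 1" "d e e' = 1" "d e' e = 1" "d c' e' = 1" "d e' c' = 1"
      using assms adj_sym dc_adj by blast+
    then have "c = e'"
      using 1 2 3 4 by (intro median_unique[of c' c e x e']) (auto simp: dc_sym)
    with assms show False by simp
  qed
qed

lemma W_square:
  assumes "adj c e" "adj c' e'" "adj c c'" "adj e e'" "c \<noteq> e'" "c' \<noteq> e"
  shows "W c e = W c' e'"
  using W_square_subset[of c e c' e'] W_square_subset[of c' e' c e] assms adj_sym
  by (metis subset_antisym)

text \<open>An edge crossing a hyperplane is slid through squares towards the edge defining it.\<close>

lemma W_crossed:
  assumes "adj a b" "adj c e" "c \<notin> W a b" "e \<in> W a b"
  shows "W a b = W c e"
  using assms
proof (induction "d c a" arbitrary: c e)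
  case 0
  then have "c = a" by simp
  moreover have "e = b"
    using 0 \<open>c = a\<close> by (auto simp: dc_W_iff dc_adj dc_sym[of e a])
  ultimately show ?case by simp
next
  case (Suc k)
  have cb: "d c b = Suc (Suc k)"
    using Suc by (simp add: dc_not_W_iff)
  have ea: "d e a = Suc (d e b)"
    using Suc by (simp add: dc_W_iff)
  have eb: "d e b = Suc k"
    using bipartite[OF \<open>adj c e\<close>, of a] bipartite[OF \<open>adj c e\<close>, of b] cb ea Suc(2)
      dc_sym[of a c] dc_sym[of a e] dc_sym[of b c] dc_sym[of b e] by linarith
  obtain c' where c': "adj c c'" "d c a = Suc (d c' a)"
    using Suc(2) closer_neighbour by (metis dc_eq_0 nat.distinct(1))
  have c'a: "d c' a = k" using c' Suc by simp
  have c'b: "d c' b = Suc k"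
    using bipartite[OF \<open>adj c c'\<close>, of b] bipartite[OF \<open>adj a b\<close>, of c'] cb c'a
      dc_sym[of b c] dc_sym[of b c'] dc_sym[of a c'] by linarith
  have ne: "c' \<noteq> e" using c'a ea eb by auto
  have c'e: "d c' e = 2"
    using bipartite[OF \<open>adj c e\<close>, of c'] dc_adj[OF adj_sym[OF c'(1)]] ne by auto
  obtain e' where m: "d c' e' + d e' e = d c' e" "d e e' + d e' b = d e b" "d c' e' + d e' b = d c' b"
    by (rule median_exists)
  then have "d c' e' = 1" "d e e' = 1" and e'b: "d e' b = k"
    using c'e eb c'b dc_sym[of e e'] by linarith+
  then have adj': "adj c' e'" "adj e e'"
    by (simp_all add: adj_iff_dc)
  have e'a: "d e' a = Suc k"
    using bipartite[OF adj'(1), of a] bipartite[OF adj'(2), of a] c'a ea eb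
      dc_sym[of a c'] dc_sym[of a e'] dc_sym[of a e] by linarith
  have "W a b = W c' e'"
    using Suc(1)[of c' e'] adj' c'a c'b e'a e'b \<open>adj a b\<close> by (simp add: dc_W_iff dc_not_W_iff)
  also have "\<dots> = W c e"
  proof -
    have "c \<noteq> e'" using cb e'b by auto
    then show ?thesis
      using W_square[of c e c' e'] adj' c'(1) \<open>adj c e\<close> ne by simp
  qed
  finally show ?case .
qed

lemma halfspace_crossed:
  assumes "P \<in> H" "adj c e" "c \<notin> P" "e \<in> P"
  shows "P = W c e"
  using assms W_crossed unfolding halfspaces_W by blast

text \<open>An edge crosses a single hyperplane, so each step of a geodesic from \<open>x\<close> to
  \<open>y\<close> contributes at most one halfspace.\<close>

lemma finite_hs_between: "finite (hs_between adj x y)"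
proof (induction "d x y" arbitrary: x)
  case 0
  then show ?case by (simp add: hs_between_def)
next
  case (Suc n)
  then obtain z where z: "adj x z" "d x y = Suc (d z y)"
    by (metis closer_neighbour dc_eq_0 nat.distinct(1))
  have "hs_between adj x y \<subseteq> insert (W x z) (hs_between adj z y)"
    using halfspace_crossed z by (auto simp: hs_between_def)
  with Suc z show ?case
    by (metis Suc_inject finite_insert finite_subset)
qed

text \<open>The first step from \<open>x\<close> towards \<open>m\<close> also leads towards
  \<open>y\<close>. If it left \<open>P\<close>, then \<open>P\<close> would consist of the vertices
  closer to \<open>x\<close> than to the new vertex, which excludes \<open>y\<close>.\<close>

lemma halfspace_convex:
  assumes "P \<in> H" "x \<in> P" "y \<in> P" "d x m + d m y = d x y"
  shows "m \<in> P"
  using assms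
proof (induction "d x m" arbitrary: x)
  case 0
  then show ?case by simp
next
  case (Suc n)
  then obtain z where z: "adj x z" "d x m = Suc (d z m)"
    by (metis closer_neighbour dc_eq_0 nat.distinct(1))
  have zy: "d x y = Suc (d z y)" "d z m + d m y = d z y"
    using bipartite[OF z(1), of y] z Suc dc_triangle[of z y m] by (auto simp: dc_sym)
  have "z \<in> P"
  proof (rule ccontr)
    assume "z \<notin> P"
    then have "P = W z x"
      using halfspace_crossed Suc z adj_sym by blast
    with Suc zy show False by (auto simp: W_def dc_sym)
  qed
  then show ?case
    using Suc z zy by auto
qed

end

section \<open>Nested halfspaces and segments\<close>

lemma nested_compl_right: "nested A (- B) \<longleftrightarrow> nested A B"
  by (auto simp: nested_def)

text \<open>Here \<open>y\<close> prevents \<open>P\<close> and \<open>Q\<close> from being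
  disjoint, and \<open>x\<close> prevents their complements from being disjoint.\<close>

lemma nested_comparable:
  "nested P Q \<Longrightarrow> x \<notin> P \<Longrightarrow> x \<notin> Q \<Longrightarrow> y \<in> P \<Longrightarrow> y \<in> Q \<Longrightarrow> P \<subseteq> Q \<or> Q \<subseteq> P"
  by (auto simp: nested_def)

lemma segment_nth_mono:
  assumes "segment adj \<gamma>" "i \<le> j" "j < length \<gamma>"
  shows "\<gamma> ! j \<subseteq> \<gamma> ! i"
  using assms(2,3)
proof (induction j rule: dec_induct)
  case (step n)
  then have "tight_sup (halfspaces adj) (\<gamma> ! n) (\<gamma> ! Suc n)"
    using assms(1) by (simp add: segment_def)
  with step show ?case by (auto simp: tight_sup_def)
qed simp

lemma segment_member_bounds:
  assumes "segment adj \<gamma>" "A \<in> set \<gamma>"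
  shows "A \<subseteq> hd \<gamma>" "last \<gamma> \<subseteq> A"
proof -
  obtain i where "i < length \<gamma>" "A = \<gamma> ! i"
    using assms(2) by (metis in_set_conv_nth)
  moreover have "\<gamma> \<noteq> []" using assms(2) by auto
  ultimately show "A \<subseteq> hd \<gamma>" "last \<gamma> \<subseteq> A"
    using segment_nth_mono[OF assms(1)] by (auto simp: hd_conv_nth last_conv_nth)
qed

lemma segment_snoc:
  assumes "segment adj \<gamma>" "C \<in> halfspaces adj" "tight_sup (halfspaces adj) (last \<gamma>) C"
  shows "segment adj (\<gamma> @ [C])"
  using assms by (auto simp: segment_def nth_append last_conv_nth less_Suc_eq split: if_splits)
    (metis diff_Suc_Suc minus_nat.diff_0)

lemma segment_Cons:
  assumes "segment adj \<gamma>" "C \<in> halfspaces adj" "tight_sup (halfspaces adj) C (hd \<gamma>)"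
  shows "segment adj (C # \<gamma>)"
  using assms by (auto simp: segment_def hd_conv_nth nth_Cons split: nat.split)

text \<open>Each halfspace of \<tau> is strictly contained in each halfspace of \<sigma>, so none
  are equal or transverse.\<close>

lemma seg_gt_not_overlap:
  assumes "segment adj \<sigma>" "segment adj \<tau>" "seg_gt \<sigma> \<tau>"
  shows "\<not> overlap \<sigma> \<tau>" "\<not> overlap \<tau> \<sigma>"
proof -
  have "B \<subset> A" if "A \<in> set \<sigma>" "B \<in> set \<tau>" for A B
    using segment_member_bounds[OF assms(1) that(1)] segment_member_bounds[OF assms(2) that(2)] assms(3)
    unfolding seg_gt_def by blast
  then show "\<not> overlap \<sigma> \<tau>" "\<not> overlap \<tau> \<sigma>"
    unfolding overlap_def transverse_def nested_def by blast+
qed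

lemma (in median) halfspace_proper:
  assumes "P \<in> H"
  obtains x y where "x \<notin> P" "y \<in> P"
proof -
  obtain x y where "adj x y" "P = W x y"
    using assms by (auto simp: halfspaces_W)
  then have "x \<notin> P" "y \<in> P"
    by (auto simp: W_def dc_adj adj_sym)
  then show ?thesis by (rule that)
qed

lemma (in median) tight_sup_compl: "tight_sup H A B \<Longrightarrow> tight_sup H (- B) (- A)"
proof -
  assume t: "tight_sup H A B"
  have "\<not> (- A \<subset> C \<and> C \<subset> - B)" if "C \<in> H" for C
  proof
    assume "- A \<subset> C \<and> C \<subset> - B"
    then have "B \<subset> - C" "- C \<subset> A" by auto
    with t halfspace_compl[OF that] show False by (auto simp: tight_sup_def)
  qed
  with t show ?thesis by (auto simp: tight_sup_def)
qed

text \<open>Halfspaces between \<open>B\<close> and \<open>A\<close> all separate a vertex outside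
  \<open>A\<close> from a vertex of \<open>B\<close>, so there are finitely many, and a maximal one
  properly inside \<open>A\<close> is tight.\<close>

lemma (in median) tight_below:
  assumes "A \<in> H" "B \<in> H" "B \<subset> A"
  obtains C where "C \<in> H" "tight_sup H A C" "B \<subseteq> C"
proof -
  let ?S = "{C \<in> H. B \<subseteq> C \<and> C \<subset> A}"
  obtain x where "x \<notin> A" using assms(1) by (rule halfspace_proper)
  obtain y where "y \<in> B" using assms(2) by (rule halfspace_proper)
  have "?S \<subseteq> hs_between adj x y"
    using \<open>x \<notin> A\<close> \<open>y \<in> B\<close> by (auto simp: hs_between_def)
  then have "finite ?S"
    using finite_hs_between by (rule finite_subset)
  moreover have "B \<in> ?S" using assms by auto
  ultimately obtain C where C: "C \<in> ?S" "\<forall>D\<in>?S. C \<subseteq> D \<longrightarrow> D = C"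
    by (metis (no_types, lifting) finite_has_maximal empty_iff)
  show ?thesis
  proof (rule that)
    show "tight_sup H A C"
      unfolding tight_sup_def
    proof (intro conjI notI; (elim bexE conjE)?)
      fix D assume D: "D \<in> H" "C \<subset> D" "D \<subset> A"
      then have "D \<in> ?S" using C(1) by auto
      with C(2) D(2) show False by auto
    qed (use C(1) in simp)
  qed (use C in auto)
qed

text \<open>Complementation reduces this to \<open>tight_below\<close>.\<close>

lemma (in median) tight_above:
  assumes "A \<in> H" "B \<in> H" "B \<subset> A"
  obtains C where "C \<in> H" "tight_sup H C B" "C \<subseteq> A"
proof -
  obtain C where C: "C \<in> H" "tight_sup H (- B) C" "- A \<subseteq> C"
    using tight_below[of "- B" "- A"] assms halfspace_compl by auto
  then have "- C \<in> H" "tight_sup H (- C) B" "- C \<subseteq> A"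
    using halfspace_compl tight_sup_compl[of "- B" C] by auto
  then show ?thesis by (rule that)
qed

section \<open>RAAG-like actions and counts of copies\<close>

locale raag_action = median adj for adj :: "'v \<Rightarrow> 'v \<Rightarrow> bool" +
  fixes G :: "('g, 'm) monoid_scheme" (structure) and act :: "'g \<Rightarrow> 'v \<Rightarrow> 'v"
  assumes action: "cube_action G adj act" and raag: "raag_like G adj act"

sublocale raag_action \<subseteq> group G
  using action by (simp add: cube_action_def)

context raag_action
begin

section \<open>Transport of distances, halfspaces and tightness by the action\<close>

lemma act_mult: "h \<in> carrier G \<Longrightarrow> k \<in> carrier G \<Longrightarrow> act (h \<otimes> k) x = act h (act k x)"
  using action by (simp add: cube_action_def)

lemma act_one [simp]: "act \<one> x = x"
  using action by (simp add: cube_action_def)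

lemma bij_act: "h \<in> carrier G \<Longrightarrow> bij (act h)"
  using action by (simp add: cube_action_def)

lemma inj_act: "h \<in> carrier G \<Longrightarrow> inj (act h)"
  by (simp add: bij_act bij_is_inj)

lemma act_adj: "h \<in> carrier G \<Longrightarrow> adj (act h x) (act h y) \<longleftrightarrow> adj x y"
  using action by (simp add: cube_action_def)

lemma act_inv [simp]: "h \<in> carrier G \<Longrightarrow> act (inv h) (act h x) = x"
  by (metis act_mult act_one inv_closed l_inv)

lemma act_inv' [simp]: "h \<in> carrier G \<Longrightarrow> act h (act (inv h) x) = x"
  by (metis act_mult act_one inv_closed r_inv)

lemma dc_act_le: "h \<in> carrier G \<Longrightarrow> d (act h x) (act h y) \<le> d x y"
proof (induction "d x y" arbitrary: x)
  case 0
  then show ?case by simp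
next
  case (Suc n)
  then obtain z where z: "adj x z" "d x y = Suc (d z y)"
    by (metis closer_neighbour dc_eq_0 nat.distinct(1))
  then have "d (act h z) (act h y) \<le> d z y" "d (act h x) (act h z) = 1"
    using Suc by (auto simp: dc_adj act_adj)
  then show ?case
    using z dc_triangle[of "act h x" "act h y" "act h z"] by linarith
qed

lemma dc_act [simp]: "h \<in> carrier G \<Longrightarrow> d (act h x) (act h y) = d x y"
  using dc_act_le[of h x y] dc_act_le[of "inv h" "act h x" "act h y"] by simp

lemma act_mem_image [simp]: "h \<in> carrier G \<Longrightarrow> act h x \<in> act h ` P \<longleftrightarrow> x \<in> P"
  by (simp add: inj_act inj_image_mem_iff)

lemma mem_image_act: "h \<in> carrier G \<Longrightarrow> x \<in> act h ` P \<longleftrightarrow> act (inv h) x \<in> P"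
  by (metis act_inv' act_mem_image)

lemma image_act_mult: "h \<in> carrier G \<Longrightarrow> k \<in> carrier G \<Longrightarrow> act h ` act k ` P = act (h \<otimes> k) ` P"
  by (auto simp: act_mult image_image)

lemma image_act_inv [simp]: "h \<in> carrier G \<Longrightarrow> act (inv h) ` act h ` P = P"
  by (simp add: image_image)

lemma image_act_inv' [simp]: "h \<in> carrier G \<Longrightarrow> act h ` act (inv h) ` P = P"
  by (simp add: image_image)

lemma image_act_Compl: "h \<in> carrier G \<Longrightarrow> act h ` (- P) = - act h ` P"
  by (simp add: bij_act bij_image_Compl_eq)

lemma image_act_subset [simp]: "h \<in> carrier G \<Longrightarrow> act h ` P \<subseteq> act h ` Q \<longleftrightarrow> P \<subseteq> Q"
  by (simp add: inj_act inj_image_subset_iff)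

lemma image_act_psubset [simp]: "h \<in> carrier G \<Longrightarrow> act h ` P \<subset> act h ` Q \<longleftrightarrow> P \<subset> Q"
  by (simp add: psubset_eq inj_act inj_image_eq_iff)

lemma image_act_W: "h \<in> carrier G \<Longrightarrow> act h ` W x y = W (act h x) (act h y)"
proof (rule Set.set_eqI)
  fix v assume h: "h \<in> carrier G"
  have "d (act (inv h) v) u = d v (act h u)" for u
    using dc_act[OF h, of "act (inv h) v" u] h by simp
  then show "v \<in> act h ` W x y \<longleftrightarrow> v \<in> W (act h x) (act h y)"
    using h by (simp add: mem_image_act W_def)
qed

lemma image_act_halfspace: "h \<in> carrier G \<Longrightarrow> P \<in> H \<Longrightarrow> act h ` P \<in> H"
  unfolding halfspaces_W using act_adj image_act_W by blast

lemma image_act_between: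
  "h \<in> carrier G \<Longrightarrow> P \<in> hs_between adj x y \<Longrightarrow> act h ` P \<in> hs_between adj (act h x) (act h y)"
  by (simp add: hs_between_def image_act_halfspace)

lemma image_act_tight:
  assumes "h \<in> carrier G" "tight_sup H A B"
  shows "tight_sup H (act h ` A) (act h ` B)"
  unfolding tight_sup_def
proof (intro conjI notI; (elim bexE conjE)?)
  fix C assume C: "C \<in> H" "act h ` B \<subset> C" "C \<subset> act h ` A"
  then have "act (inv h) ` C \<in> H" "B \<subset> act (inv h) ` C" "act (inv h) ` C \<subset> A"
    using assms(1) image_act_halfspace image_act_psubset[of "inv h" "act h ` B" C]
      image_act_psubset[of "inv h" C "act h ` A"] by simp_all
  then show False
    using assms(2) by (auto simp: tight_sup_def)
qed (use assms in \<open>simp add: tight_sup_def\<close>)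

lemma no_flip: "P \<in> H \<Longrightarrow> h \<in> carrier G \<Longrightarrow> act h ` (- P) \<noteq> P"
  using raag by (simp add: raag_like_def Let_def)

lemma nested_copy: "P \<in> H \<Longrightarrow> h \<in> carrier G \<Longrightarrow> nested P (act h ` P)"
  using raag by (simp add: raag_like_def Let_def transverse_def)

lemma nested_tight_copy:
  "P \<in> H \<Longrightarrow> Q \<in> H \<Longrightarrow> tight_sup H Q P \<Longrightarrow> h \<in> carrier G \<Longrightarrow> nested P (act h ` Q)"
  using raag by (auto simp: raag_like_def Let_def transverse_def tightly_nested_def)

lemma no_tight_flip: "P \<in> H \<Longrightarrow> h \<in> carrier G \<Longrightarrow> \<not> tight_sup H (act h ` (- P)) P"
  using raag by (simp add: raag_like_def Let_def)

section \<open>Packings by non-overlapping copies\<close>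

definition copies :: "'v set list \<Rightarrow> 'v set list set" where
  "copies \<gamma> = {seg_copy act h \<gamma> | h. h \<in> carrier G}"

definition packing :: "'v set list \<Rightarrow> 'v \<Rightarrow> 'v \<Rightarrow> 'v set list set \<Rightarrow> bool" where
  "packing \<gamma> x y S \<longleftrightarrow> finite S \<and> S \<subseteq> copies \<gamma> \<and> (\<forall>\<sigma>\<in>S. seg_in adj \<sigma> x y) \<and>
     (\<forall>\<sigma>\<in>S. \<forall>\<tau>\<in>S. \<sigma> \<noteq> \<tau> \<longrightarrow> \<not> overlap \<sigma> \<tau>)"

abbreviation count :: "'v set list \<Rightarrow> 'v \<Rightarrow> 'v \<Rightarrow> nat" where
  "count \<equiv> seg_count G adj act"

lemma count_packing: "count \<gamma> x y = Max {card S | S. packing \<gamma> x y S}"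
  by (simp add: seg_count_def packing_def copies_def)

text \<open>Needed to make sense of \<open>Max\<close> in the count: copies have the length of
  \<gamma> and use only the finitely many halfspaces from \<open>x\<close> to
  \<open>y\<close>.\<close>

lemma finite_packings: "finite {card S | S. packing \<gamma> x y S}"
proof -
  let ?L = "{\<sigma>. set \<sigma> \<subseteq> hs_between adj x y \<and> length \<sigma> = length \<gamma>}"
  have "finite ?L"
    by (intro finite_lists_length_eq finite_hs_between)
  moreover have "{S. packing \<gamma> x y S} \<subseteq> Pow ?L"
    by (auto simp: packing_def copies_def seg_in_def seg_copy_def)
  ultimately have "finite {S. packing \<gamma> x y S}"
    by (meson finite_Pow_iff finite_subset)
  then show ?thesis by simp
qed

lemma packing_le_count: "packing \<gamma> x y S \<Longrightarrow> card S \<le> count \<gamma> x y"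
  unfolding count_packing by (rule Max_ge[OF finite_packings]) blast

lemma count_attained:
  obtains S where "packing \<gamma> x y S" "card S = count \<gamma> x y"
proof -
  have "packing \<gamma> x y {}" by (simp add: packing_def)
  then have "{card S | S. packing \<gamma> x y S} \<noteq> {}" by blast
  then have "count \<gamma> x y \<in> {card S | S. packing \<gamma> x y S}"
    unfolding count_packing by (rule Max_in[OF finite_packings])
  with that show ?thesis by auto
qed

lemma seg_copy_mult:
  "h \<in> carrier G \<Longrightarrow> k \<in> carrier G \<Longrightarrow> seg_copy act h (seg_copy act k \<gamma>) = seg_copy act (h \<otimes> k) \<gamma>"
  by (simp add: seg_copy_def image_act_mult)

lemma seg_copy_inv: "h \<in> carrier G \<Longrightarrow> seg_copy act (inv h) (seg_copy act h \<gamma>) = \<gamma>"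
  by (simp add: seg_copy_def comp_def)

lemma segment_copy: "h \<in> carrier G \<Longrightarrow> segment adj \<gamma> \<Longrightarrow> segment adj (seg_copy act h \<gamma>)"
  by (auto simp: segment_def seg_copy_def image_act_halfspace image_act_tight)

lemma segment_copies: "\<sigma> \<in> copies \<gamma> \<Longrightarrow> segment adj \<gamma> \<Longrightarrow> segment adj \<sigma>"
  using segment_copy by (auto simp: copies_def)

lemma overlap_copy:
  assumes h: "h \<in> carrier G"
  shows "overlap (seg_copy act h \<sigma>) (seg_copy act h \<tau>) \<longleftrightarrow> overlap \<sigma> \<tau>"
proof -
  have "nested (act h ` A) (act h ` B) \<longleftrightarrow> nested A B" for A B
    using h by (simp add: nested_def flip: image_act_Compl)
  moreover have "act h ` A = act h ` B \<longleftrightarrow> A = B" for A B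
    using h by (simp add: inj_act inj_image_eq_iff)
  ultimately show ?thesis
    by (simp add: overlap_def seg_copy_def transverse_def)
qed

lemma packing_copy:
  assumes h: "h \<in> carrier G" and S: "packing \<gamma> x y S"
  shows "packing \<gamma> (act h x) (act h y) (seg_copy act h ` S)"
  unfolding packing_def
proof (intro conjI)
  show "seg_copy act h ` S \<subseteq> copies \<gamma>"
    using S h seg_copy_mult unfolding packing_def copies_def by blast
  show "\<forall>\<sigma>\<in>seg_copy act h ` S. seg_in adj \<sigma> (act h x) (act h y)"
    using S h by (auto simp: packing_def seg_in_def seg_copy_def intro!: image_act_between)
  show "\<forall>\<sigma>\<in>seg_copy act h ` S. \<forall>\<tau>\<in>seg_copy act h ` S. \<sigma> \<noteq> \<tau> \<longrightarrow> \<not> overlap \<sigma> \<tau>"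
    using S h by (auto simp: packing_def overlap_copy)
qed (use S in \<open>simp add: packing_def\<close>)

lemma count_act_le:
  assumes h: "h \<in> carrier G"
  shows "count \<gamma> x y \<le> count \<gamma> (act h x) (act h y)"
proof -
  obtain S where S: "packing \<gamma> x y S" "card S = count \<gamma> x y"
    by (rule count_attained)
  have "inj_on (seg_copy act h) S"
    by (metis h inj_on_inverseI seg_copy_inv)
  then have "card (seg_copy act h ` S) = count \<gamma> x y"
    using S by (simp add: card_image)
  with packing_le_count[OF packing_copy[OF h S(1)]] show ?thesis by simp
qed

lemma count_act: "h \<in> carrier G \<Longrightarrow> count \<gamma> (act h x) (act h y) = count \<gamma> x y"
  using count_act_le[of h \<gamma> x y] count_act_le[of "inv h" \<gamma> "act h x" "act h y"] by simp

text \<open>The two first halfspaces lie in one orbit of \<open>G\<close>, hence are nested, and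
  both separate \<open>x\<close> from \<open>y\<close>.\<close>

lemma hd_copies_comparable:
  assumes "segment adj \<gamma>" "\<sigma> \<in> copies \<gamma>" "\<tau> \<in> copies \<gamma>" "seg_in adj \<sigma> x y" "seg_in adj \<tau> x y"
  shows "hd \<sigma> \<subseteq> hd \<tau> \<or> hd \<tau> \<subseteq> hd \<sigma>"
proof -
  obtain h k where hk: "h \<in> carrier G" "\<sigma> = seg_copy act h \<gamma>" "k \<in> carrier G" "\<tau> = seg_copy act k \<gamma>"
    using assms by (auto simp: copies_def)
  have ne: "\<gamma> \<noteq> []" and "hd \<gamma> \<in> H" using assms(1) by (auto simp: segment_def)
  have "hd \<tau> = act (k \<otimes> inv h) ` hd \<sigma>"
    using hk ne by (simp add: seg_copy_def hd_map flip: image_act_mult)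
  moreover have "hd \<sigma> \<in> H"
    using hk ne \<open>hd \<gamma> \<in> H\<close> by (simp add: seg_copy_def hd_map image_act_halfspace)
  ultimately have "nested (hd \<sigma>) (hd \<tau>)"
    using nested_copy hk by simp
  moreover have "hd \<sigma> \<in> hs_between adj x y" "hd \<tau> \<in> hs_between adj x y"
    using assms(4,5) hk(2,4) ne by (simp_all add: seg_in_def seg_copy_def hd_map image_subset_iff)
  ultimately show ?thesis
    using nested_comparable[of "hd \<sigma>" "hd \<tau>" x y] by (auto simp: hs_between_def)
qed

text \<open>A halfspace that is nested with and distinct from all members of a segment cannot slip
  between two consecutive ones, so two non-overlapping copies never interleave.\<close>

lemma not_overlap_seg_gt:
  assumes \<gamma>: "segment adj \<gamma>" and \<sigma>: "\<sigma> \<in> copies \<gamma>" "seg_in adj \<sigma> x y"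
    and \<tau>: "\<tau> \<in> copies \<gamma>" "seg_in adj \<tau> x y"
    and no: "\<not> overlap \<sigma> \<tau>" and sub: "hd \<tau> \<subseteq> hd \<sigma>"
  shows "seg_gt \<sigma> \<tau>"
proof -
  have seg: "segment adj \<sigma>" "segment adj \<tau>"
    using \<gamma> \<sigma> \<tau> segment_copies by auto
  then have ne: "\<sigma> \<noteq> []" "\<tau> \<noteq> []" by (auto simp: segment_def)
  have cmp: "A \<subset> hd \<tau> \<or> hd \<tau> \<subset> A" if "A \<in> set \<sigma>" for A
  proof -
    have "A \<noteq> hd \<tau>" "nested A (hd \<tau>)"
      using no that ne by (auto simp: overlap_def transverse_def)
    moreover have "A \<in> hs_between adj x y" "hd \<tau> \<in> hs_between adj x y"
      using \<sigma>(2) \<tau>(2) that ne by (auto simp: seg_in_def)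
    ultimately show ?thesis
      using nested_comparable[of A "hd \<tau>" x y] by (auto simp: hs_between_def)
  qed
  have "hd \<tau> \<subset> \<sigma> ! i" if "i < length \<sigma>" for i
    using that
  proof (induction i)
    case 0
    then show ?case
      using sub ne cmp[of "hd \<sigma>"] by (auto simp: hd_conv_nth[symmetric])
  next
    case (Suc i)
    then have "tight_sup H (\<sigma> ! i) (\<sigma> ! Suc i)" "hd \<tau> \<subset> \<sigma> ! i"
      using seg(1) by (auto simp: segment_def)
    moreover have "hd \<tau> \<in> H"
      using seg(2) ne by (auto simp: segment_def)
    ultimately have "\<not> \<sigma> ! Suc i \<subset> hd \<tau>"
      by (auto simp: tight_sup_def)
    with cmp[of "\<sigma> ! Suc i"] Suc.prems show ?case by auto
  qed
  then show ?thesis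
    using ne by (simp add: seg_gt_def last_conv_nth)
qed

text \<open>Cut a largest packing from \<open>x\<close> to \<open>z\<close> at \<open>y\<close>:
  \<open>S1\<close> lies between \<open>x\<close> and \<open>y\<close>, \<open>S2\<close> between
  \<open>y\<close> and \<open>z\<close>, and at most one copy straddles \<open>y\<close>.\<close>

lemma count_subadditive:
  assumes \<gamma>: "segment adj \<gamma>"
  shows "count \<gamma> x z \<le> count \<gamma> x y + count \<gamma> y z + 1"
proof -
  obtain S where S: "packing \<gamma> x z S" "card S = count \<gamma> x z"
    by (rule count_attained)
  have seg: "segment adj \<sigma>" "\<sigma> \<noteq> []" if "\<sigma> \<in> S" for \<sigma>
  proof -
    show "segment adj \<sigma>"
      using that S(1) \<gamma> segment_copies by (auto simp: packing_def)
    then show "\<sigma> \<noteq> []" by (simp add: segment_def)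
  qed
  define S1 where "S1 = {\<sigma>\<in>S. y \<in> last \<sigma>}"
  define S2 where "S2 = {\<sigma>\<in>S. y \<notin> hd \<sigma>}"
  define S3 where "S3 = {\<sigma>\<in>S. y \<in> hd \<sigma> \<and> y \<notin> last \<sigma>}"
  have "packing \<gamma> x y S1"
    using S(1) segment_member_bounds(2)[OF seg(1)]
    by (fastforce simp: packing_def S1_def seg_in_def hs_between_def)
  moreover have "packing \<gamma> y z S2"
    using S(1) segment_member_bounds(1)[OF seg(1)]
    by (fastforce simp: packing_def S2_def seg_in_def hs_between_def)
  moreover have "card S3 \<le> 1"
  proof -
    have "\<sigma> = \<tau>" if "\<sigma> \<in> S3" "\<tau> \<in> S3" for \<sigma> \<tau>
    proof (rule ccontr)
      assume "\<sigma> \<noteq> \<tau>"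
      moreover have "hd \<sigma> \<subseteq> hd \<tau> \<or> hd \<tau> \<subseteq> hd \<sigma>"
        using that S(1) by (intro hd_copies_comparable[OF \<gamma>, of _ _ x z]) (auto simp: S3_def packing_def)
      \<comment> \<open>Of two straddling copies, the last halfspace of the earlier one would
        contain the first halfspace of the later one, hence \<open>y\<close>.\<close>
      ultimately have "seg_gt \<sigma> \<tau> \<or> seg_gt \<tau> \<sigma>"
        using not_overlap_seg_gt[OF \<gamma>, of _ x z] that S(1) by (auto simp: S3_def packing_def subset_iff)
      with that show False by (auto simp: seg_gt_def S3_def)
    qed
    then show ?thesis
      using S(1) by (simp add: card_le_Suc0_iff_eq packing_def S3_def)
  qed
  moreover have "S = S1 \<union> S2 \<union> S3"
    by (auto simp: S1_def S2_def S3_def)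
  then have "card S \<le> card S1 + card S2 + card S3"
    using card_Un_le[of S1 S2] card_Un_le[of "S1 \<union> S2" S3] by simp
  ultimately show ?thesis
    using S(2) packing_le_count[of \<gamma> x y S1] packing_le_count[of \<gamma> y z S2] by linarith
qed

text \<open>Copies before and after \<open>y\<close> may overlap, but discarding the copy nearest to
  \<open>y\<close> from the first packing separates the two packings.\<close>

lemma count_superadditive:
  assumes \<gamma>: "segment adj \<gamma>"
    and xy: "hs_between adj x y \<subseteq> hs_between adj x z"
    and yz: "hs_between adj y z \<subseteq> hs_between adj x z"
  shows "count \<gamma> x y + count \<gamma> y z \<le> count \<gamma> x z + 1"
proof -
  obtain S where S: "packing \<gamma> x y S" "card S = count \<gamma> x y"
    by (rule count_attained)
  obtain R where R: "packing \<gamma> y z R" "card R = count \<gamma> y z"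
    by (rule count_attained)
  have R': "packing \<gamma> x z R"
    using R(1) yz by (auto simp: packing_def seg_in_def)
  have S': "packing \<gamma> x z S"
    using S(1) xy by (auto simp: packing_def seg_in_def)
  have seg: "segment adj \<sigma>" "\<sigma> \<noteq> []" if "\<sigma> \<in> S \<union> R" for \<sigma>
  proof -
    show "segment adj \<sigma>"
      using that S(1) R(1) \<gamma> segment_copies by (auto simp: packing_def)
    then show "\<sigma> \<noteq> []" by (simp add: segment_def)
  qed
  show ?thesis
  proof (cases "S = {}")
    case True
    with S(2) R(2) packing_le_count[OF R'] show ?thesis by simp
  next
    case False
    have "finite S" using S(1) by (simp add: packing_def)
    \<comment> \<open>The discarded copy \<alpha> has the smallest first halfspace. It serves as a
      barrier: \<open>hd \<alpha>\<close> lies inside \<open>last \<sigma>\<close> for every other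
      \<sigma> in \<open>S\<close>, and contains \<open>hd \<tau>\<close> for every \<tau> in
      \<open>R\<close>, because \<open>y\<close> is in \<open>hd \<alpha>\<close> but not in
      \<open>hd \<tau>\<close>.\<close>
    then obtain P where P: "P \<in> hd ` S" "\<forall>Q\<in>hd ` S. Q \<subseteq> P \<longrightarrow> P = Q"
      using False finite_has_minimal[of "hd ` S"] by auto
    then obtain \<alpha> where \<alpha>: "\<alpha> \<in> S" "P = hd \<alpha>" by auto
    have gt: "seg_gt \<sigma> \<tau>" if \<sigma>: "\<sigma> \<in> S - {\<alpha>}" and \<tau>: "\<tau> \<in> R" for \<sigma> \<tau>
    proof -
      have "hd \<sigma> \<subseteq> hd \<alpha> \<or> hd \<alpha> \<subseteq> hd \<sigma>"
        using \<sigma> \<alpha> S(1) by (intro hd_copies_comparable[OF \<gamma>, of _ _ x y]) (auto simp: packing_def)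
      then have "hd \<alpha> \<subseteq> hd \<sigma>"
        using P \<alpha> \<sigma> by auto
      then have 1: "hd \<alpha> \<subset> last \<sigma>"
        using not_overlap_seg_gt[OF \<gamma>, of \<sigma> x y \<alpha>] \<sigma> \<alpha> S(1)
        by (auto simp: packing_def seg_gt_def subset_iff)
      have "hd \<alpha> \<subseteq> hd \<tau> \<or> hd \<tau> \<subseteq> hd \<alpha>"
        using \<tau> \<alpha> S' R' by (intro hd_copies_comparable[OF \<gamma>, of _ _ x z]) (auto simp: packing_def)
      moreover have "y \<in> hd \<alpha>" "y \<notin> hd \<tau>"
        using \<alpha> \<tau> S(1) R(1) seg(2) by (auto simp: packing_def seg_in_def hs_between_def subset_iff)
      ultimately show ?thesis
        using 1 by (auto simp: seg_gt_def)
    qed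
    have no: "\<not> overlap \<sigma> \<tau>" "\<not> overlap \<tau> \<sigma>" "\<sigma> \<noteq> \<tau>" if "\<sigma> \<in> S - {\<alpha>}" "\<tau> \<in> R" for \<sigma> \<tau>
    proof -
      show no: "\<not> overlap \<sigma> \<tau>" "\<not> overlap \<tau> \<sigma>"
        using seg_gt_not_overlap[OF _ _ gt[OF that]] seg(1) that by auto
      show "\<sigma> \<noteq> \<tau>"
        using no seg(2)[of \<sigma>] that hd_in_set[of \<sigma>] unfolding overlap_def by blast
    qed
    have "packing \<gamma> x z ((S - {\<alpha>}) \<union> R)"
      unfolding packing_def
    proof (intro conjI ballI impI)
      fix \<sigma> \<tau> assume "\<sigma> \<in> S - {\<alpha>} \<union> R" "\<tau> \<in> S - {\<alpha>} \<union> R" "\<sigma> \<noteq> \<tau>"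
      then show "\<not> overlap \<sigma> \<tau>"
        using no S' R' unfolding packing_def by blast
    qed (use S' R' in \<open>auto simp: packing_def\<close>)
    moreover have "card ((S - {\<alpha>}) \<union> R) = card S - 1 + card R"
    proof -
      have "(S - {\<alpha>}) \<inter> R = {}" using no(3) by blast
      then show ?thesis
        using \<alpha> S(1) R(1) by (simp add: card_Un_disjoint packing_def)
    qed
    ultimately show ?thesis
      using packing_le_count[of \<gamma> x z "(S - {\<alpha>}) \<union> R"] S(2) R(2) by linarith
  qed
qed

end

section \<open>Homogenisation of quasi-additive sequences\<close>

lemma quasi_additive_convergent:
  fixes a :: "nat \<Rightarrow> real"
  assumes C: "\<And>m n. \<bar>a (m + n) - a m - a n\<bar> \<le> C"
  shows "convergent (\<lambda>n. a n / real n)"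
proof -
  have mult: "\<bar>a (Suc k * n) - real (Suc k) * a n\<bar> \<le> real (Suc k) * C" for k n
  proof (induction k)
    case 0
    then show ?case using C[of 0 0] by auto
  next
    case (Suc k)
    then show ?case
      using C[of n "Suc k * n"] by (simp add: algebra_simps abs_le_iff)
  qed
  \<comment> \<open>Both quotients are compared with \<open>a (m * n)\<close> divided by
    \<open>m * n\<close>, using \<open>mult\<close> in each of the two factors.\<close>
  have close: "\<bar>a n / real n - a m / real m\<bar> \<le> C / real n + C / real m" if "m > 0" "n > 0" for m n
  proof -
    have "\<bar>a (m * n) - real m * a n\<bar> \<le> real m * C" "\<bar>a (m * n) - real n * a m\<bar> \<le> real n * C"
      using mult[of "m - 1" n] mult[of "n - 1" m] that by (simp_all add: mult.commute)
    then have "\<bar>real m * a n - real n * a m\<bar> \<le> real m * C + real n * C"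
      by linarith
    moreover have "a n / real n - a m / real m = (real m * a n - real n * a m) / (real m * real n)"
      "C / real n + C / real m = (real m * C + real n * C) / (real m * real n)"
      using that by (simp_all add: field_simps)
    ultimately show ?thesis
      using that by (simp add: divide_right_mono)
  qed
  have "0 \<le> C" using C[of 0 0] by linarith
  have "Cauchy (\<lambda>n. a n / real n)"
  proof (rule metric_CauchyI)
    fix e :: real assume "e > 0"
    obtain N :: nat where N: "2 * C / e < real N"
      using reals_Archimedean2 by blast
    have small: "C / real n < e / 2" if "n \<ge> Suc N" for n
    proof -
      have "2 * C / e < real n" using N that by linarith
      then show ?thesis
        using that \<open>e > 0\<close> by (simp add: field_simps)
    qed
    have "dist (a m / real m) (a n / real n) < e" if "m \<ge> Suc N" "n \<ge> Suc N" for m n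
    proof -
      show ?thesis
        using close[of n m] small[of m] small[of n] that unfolding dist_real_def by linarith
    qed
    then show "\<exists>M. \<forall>m\<ge>M. \<forall>n\<ge>M. dist (a m / real m) (a n / real n) < e"
      by blast
  qed
  then show ?thesis by (rule Cauchy_convergent)
qed

section \<open>The orbit of a vertex of minimal displacement\<close>

locale raag_axis = raag_action adj G act
  for adj :: "'v \<Rightarrow> 'v \<Rightarrow> bool" and G :: "('g, 'm) monoid_scheme" (structure)
    and act :: "'g \<Rightarrow> 'v \<Rightarrow> 'v" +
  fixes g :: 'g and b :: 'v
  assumes g [simp]: "g \<in> carrier G"
    and displacement: "\<And>x. d b (act g b) \<le> d x (act g x)"
begin

text \<open>Integer exponents allow the orbit to be followed in both directions.\<close>

abbreviation T :: "int \<Rightarrow> 'v \<Rightarrow> 'v" where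
  "T k \<equiv> act (g [^] k)"

lemma T_add: "T i (T j x) = T (i + j) x"
  by (simp add: int_pow_mult act_mult)

lemma T_0 [simp]: "T 0 x = x"
  by simp

lemma T_1 [simp]: "T 1 x = act g x"
  by (simp add: int_pow_1)

lemma inv_T: "act (inv (g [^] (k::int))) = T (- k)"
  by (simp add: int_pow_neg)

lemma mem_T_image: "x \<in> T k ` P \<longleftrightarrow> T (- k) x \<in> P"
  by (simp add: mem_image_act inv_T)

lemma T_image_add: "T i ` T j ` P = T (i + j) ` P"
  by (simp add: image_image T_add)

text \<open>Otherwise the median of \<open>b\<close>, \<open>g b\<close>, \<open>g\<^sup>2 b\<close> differs from \<open>g b\<close>. Let \<open>x\<close> be the neighbour of \<open>g b\<close>
  towards it. Then \<open>y = g\<^sup>-\<^sup>1 x\<close> is moved less than \<open>b\<close>, unless the edge from \<open>b\<close> to \<open>y\<close> is dual to the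
  hyperplane of the edge from \<open>g b\<close> to \<open>x\<close>; but then \<open>g\<close> flips that hyperplane.\<close>

lemma no_return:
  assumes P: "P \<in> H" "b \<notin> P" "act g b \<in> P"
  shows "act g (act g b) \<in> P"
proof (rule ccontr)
  let ?b1 = "act g b" and ?b2 = "act g (act g b)"
  assume "?b2 \<notin> P"
  obtain m where m: "d b m + d m ?b1 = d b ?b1" "d ?b1 m + d m ?b2 = d ?b1 ?b2" "d b m + d m ?b2 = d b ?b2"
    by (rule median_exists)
  have "m \<in> - P"
    using halfspace_convex[of "- P" b ?b2 m] halfspace_compl P \<open>?b2 \<notin> P\<close> m by auto
  with P(3) have "?b1 \<noteq> m" by auto
  then obtain x where x: "adj ?b1 x" "d ?b1 m = Suc (d x m)"
    by (rule closer_neighbour)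
  have D: "d ?b1 ?b2 = d b ?b1" by simp
  have x0: "d b ?b1 = Suc (d b x)"
    using bipartite[OF x(1), of b] m(1) x(2) dc_triangle[of b x m] dc_sym[of m x] dc_sym[of m ?b1]
    by linarith
  have x2: "d b ?b1 = Suc (d x ?b2)"
    using bipartite[OF x(1), of ?b2] m(2) x(2) dc_triangle[of x ?b2 m] D dc_sym[of ?b2 x] dc_sym[of ?b2 ?b1]
    by linarith
  define y where "y = act (inv g) x"
  have gy: "act g y = x" by (simp add: y_def)
  have "adj b y"
    using x(1) gy act_adj[OF g, of b y] by simp
  have "d y ?b1 = d x ?b2"
    using dc_act[OF g, of y ?b1] gy by simp
  moreover have "d b ?b1 \<le> d y x"
    using displacement[of y] gy by simp
  ultimately have "y \<in> W x ?b1"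
    using x2 by (simp add: W_def)
  moreover have "b \<notin> W x ?b1"
    using x0 by (simp add: W_def)
  ultimately have "W x ?b1 = W b y"
    using W_crossed[of x ?b1 b y] x(1) \<open>adj b y\<close> adj_sym by blast
  \<comment> \<open>\<open>g\<close> takes the edge from \<open>b\<close> to \<open>y\<close> to the
    edge from \<open>g b\<close> to \<open>x\<close>, so it takes \<open>W b y\<close> to the side
    of \<open>x\<close>, while \<open>W x ?b1\<close> is the side of \<open>g b\<close>.\<close>
  then have "act g ` (- W x ?b1) = W x ?b1"
    using W_compl[OF x(1)] by (simp add: image_act_Compl image_act_W gy)
  moreover have "W x ?b1 \<in> H"
    using x(1) adj_sym halfspaces_W by blast
  ultimately show False using no_flip by simp
qed

text \<open>The orbit enters \<open>P\<close> exactly between its points of index \<open>k\<close>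
  and \<open>k + 1\<close> and is never on the wrong side before or after.\<close>

definition crossing :: "int \<Rightarrow> 'v set \<Rightarrow> bool" where
  "crossing k P \<longleftrightarrow> P \<in> H \<and> (\<forall>j. T j b \<in> P \<longleftrightarrow> k < j)"

text \<open>Comparing \<open>P\<close> with \<open>g P\<close> at \<open>b\<close> and
  \<open>g\<^sup>2 b\<close> gives inclusion one way or the other, and \<open>g b\<close>, which
  lies in \<open>P\<close> only, decides for \<open>g P\<close> inside \<open>P\<close>. Hence the
  orbit never leaves \<open>P\<close> after entering it.\<close>

lemma crossing_0:
  assumes "P \<in> hs_between adj b (act g b)"
  shows "crossing 0 P"
proof -
  have P: "P \<in> H" "b \<notin> P" "act g b \<in> P"
    using assms by (auto simp: hs_between_def)
  \<comment> \<open>Otherwise the complement of \<open>g P\<close> is entered between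
    \<open>b\<close> and \<open>g b\<close> and left again at \<open>g\<^sup>2 b\<close>, against
    \<open>no_return\<close>.\<close>
  have "act (inv g) b \<notin> P"
  proof
    assume "act (inv g) b \<in> P"
    then have "b \<notin> act g ` (- P)" "act g b \<in> act g ` (- P)"
      using P by (simp_all add: mem_image_act)
    then have "act g (act g b) \<in> act g ` (- P)"
      using no_return image_act_halfspace[OF g halfspace_compl] P(1) by blast
    with P show False by simp
  qed
  then have "b \<notin> act g ` P"
    by (simp add: mem_image_act)
  moreover have "act g (act g b) \<in> P" "act g (act g b) \<in> act g ` P"
    using no_return P by simp_all
  ultimately have "P \<subseteq> act g ` P \<or> act g ` P \<subseteq> P"
    using nested_comparable[OF nested_copy[OF P(1) g], of b "act g (act g b)"] P by blast
  moreover have "act g b \<notin> act g ` P" using P by simp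
  ultimately have sub: "act g ` P \<subseteq> P"
    using P by blast
  have step: "T (k + 1) b \<in> P" if "T k b \<in> P" for k
  proof -
    have "act g (T k b) \<in> P" using sub that by blast
    then show ?thesis
      using T_add[of 1 k b] by (simp add: add.commute)
  qed
  have "T j b \<in> P" if "j \<ge> 1" for j
    using that by (induction j rule: int_ge_induct) (use P step in auto)
  moreover have "T j b \<notin> P" if "j \<le> 0" for j
    using that
  proof (induction j rule: int_le_induct)
    case base
    then show ?case using P by simp
  next
    case (step i)
    then show ?case using step.IH \<open>\<And>k. T k b \<in> P \<Longrightarrow> T (k + 1) b \<in> P\<close>[of "i - 1"] by auto
  qed
  ultimately show ?thesis
    unfolding crossing_def using P(1) by (metis int_one_le_iff_zero_less not_le)
qed

lemma crossing_shift: "crossing k P \<Longrightarrow> crossing (k + i) (T i ` P)"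
proof -
  assume P: "crossing k P"
  have "T j b \<in> T i ` P \<longleftrightarrow> k + i < j" for j
  proof -
    have "T j b \<in> T i ` P \<longleftrightarrow> T (- i + j) b \<in> P"
      by (simp only: mem_T_image T_add)
    also have "\<dots> \<longleftrightarrow> k < - i + j"
      using P unfolding crossing_def by blast
    finally show ?thesis by linarith
  qed
  then show ?thesis
    using P image_act_halfspace unfolding crossing_def by simp
qed

text \<open>Some step of the orbit enters \<open>P\<close>; translating that step back to the one
  from \<open>b\<close> to \<open>g b\<close> reduces to \<open>crossing_0\<close>.\<close>

lemma crossing_between:
  assumes "P \<in> hs_between adj b (T (int n) b)"
  obtains k where "0 \<le> k" "k < int n" "crossing k P"
proof -
  have "P \<in> H" "b \<notin> P" using assms by (auto simp: hs_between_def)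
  have "\<exists>k<n. T (int k) b \<notin> P \<and> T (int k + 1) b \<in> P"
    if "T (int n) b \<in> P" for n
    using that
  proof (induction n)
    case 0
    with \<open>b \<notin> P\<close> show ?case by simp
  next
    case (Suc n)
    then show ?case
      by (cases "T (int n) b \<in> P") (auto simp: add.commute intro: less_SucI)
  qed
  then obtain k where k: "k < n" "T (int k) b \<notin> P" "T (int k + 1) b \<in> P"
    using assms by (auto simp: hs_between_def)
  have "T 0 b \<notin> T (- int k) ` P" "T 1 b \<in> T (- int k) ` P"
    using k unfolding mem_T_image T_add by simp_all
  then have "crossing 0 (T (- int k) ` P)"
    using image_act_halfspace[OF int_pow_closed[OF g] \<open>P \<in> H\<close>]
    by (intro crossing_0) (simp add: hs_between_def)
  then have "crossing (int k) P"
    using crossing_shift[of 0 "T (- int k) ` P" "int k"] by (simp add: T_image_add)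
  with k(1) show ?thesis by (intro that[of "int k"]) simp_all
qed

lemma crossing_halfspace: "crossing k P \<Longrightarrow> P \<in> H"
  by (simp add: crossing_def)

text \<open>The orbit point of index \<open>min k l\<close> lies outside both halfspaces and that of
  index \<open>max k l + 1\<close> inside both.\<close>

lemma crossing_comparable:
  assumes "crossing k P" "crossing l Q" "nested P Q"
  shows "P \<subseteq> Q \<or> Q \<subseteq> P"
  using nested_comparable[of P Q "T (min k l) b" "T (max k l + 1) b"] assms
  by (auto simp: crossing_def)

lemma crossing_between_iff:
  assumes "crossing k P"
  shows "P \<in> hs_between adj (T i b) (T j b) \<longleftrightarrow> i \<le> k \<and> k < j"
  using assms unfolding hs_between_def crossing_def by (simp add: not_less)

text \<open>A copy of the reverse inside the gap between \<open>\<gamma>\<close> and \<open>g\<gamma>\<close> leaves room to extend \<open>\<gamma>\<close>: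
  at its end if the new halfspace still contains \<open>g b\<close>, and at its beginning otherwise.\<close>

lemma no_reverse_in_gap:
  assumes max: "max_g_nested adj act g b \<gamma>" and h: "h \<in> carrier G"
    and cross: "\<And>P. P \<in> set \<gamma> \<Longrightarrow> \<exists>k. crossing k (act h ` (- P))"
    and Q0: "act h ` (- hd \<gamma>) \<subset> hd \<gamma>" "act g ` hd \<gamma> \<subset> act h ` (- hd \<gamma>)"
  shows False
proof -
  \<comment> \<open>These are the halfspaces of the reversed copy, indexed as in \<gamma>: they grow
    with \<open>i\<close>, while those of \<gamma> shrink.\<close>
  define Q where "Q i = act h ` (- (\<gamma> ! i))" for i
  have seg: "segment adj \<gamma>" and in_b: "set \<gamma> \<subseteq> hs_between adj b (act g b)"
    using max by (auto simp: max_g_nested_def g_nested_def seg_in_def)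
  have ne: "\<gamma> \<noteq> []" using seg by (simp add: segment_def)
  have maximal: "\<gamma>' = \<gamma>" if "g_nested adj act g b \<gamma>'" "set \<gamma> \<subseteq> set \<gamma>'" for \<gamma>'
    using max that by (auto simp: max_g_nested_def)
  have half: "\<gamma> ! i \<in> H" "Q i \<in> H" if "i < length \<gamma>" for i
  proof -
    show "\<gamma> ! i \<in> H" using seg nth_mem[OF that] by (auto simp: segment_def)
    then show "Q i \<in> H"
      unfolding Q_def by (intro image_act_halfspace[OF h] halfspace_compl)
  qed
  have hd0: "hd \<gamma> = \<gamma> ! 0" using ne by (rule hd_conv_nth)
  have tight: "tight_sup H (\<gamma> ! i) (\<gamma> ! Suc i)" "tight_sup H (Q (Suc i)) (Q i)"
    if "Suc i < length \<gamma>" for i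
    using seg that h unfolding segment_def Q_def
    by (blast intro: image_act_tight tight_sup_compl)+
  have cmp: "\<gamma> ! i \<subseteq> Q j \<or> Q j \<subseteq> \<gamma> ! i"
    if "i < length \<gamma>" "j < length \<gamma>" "nested (\<gamma> ! i) (act h ` (\<gamma> ! j))" for i j
  proof -
    have "crossing 0 (\<gamma> ! i)"
      using in_b nth_mem[OF that(1)] crossing_0 by auto
    moreover have "\<exists>k. crossing k (Q j)"
      using cross[OF nth_mem[OF that(2)]] unfolding Q_def .
    then obtain k where "crossing k (Q j)" ..
    moreover have "nested (\<gamma> ! i) (Q j)"
      using that(3) h by (simp add: Q_def image_act_Compl nested_compl_right)
    ultimately show ?thesis by (rule crossing_comparable)
  qed
  \<comment> \<open>The induction goes through \<open>Q i\<close> inside \<gamma> at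
    \<open>Suc i\<close>: the two are nested by \<open>nested_tight_copy\<close>, distinct by
    \<open>no_tight_flip\<close>, and the reverse inclusion would contradict tightness of \<gamma>.
    Tightness of the \<open>Q\<close> then gives the claim for \<open>Q (Suc i)\<close>, with
    equality excluded by \<open>no_flip\<close>.\<close>
  have below: "Q i \<subset> \<gamma> ! i" if "i < length \<gamma>" for i
    using that
  proof (induction i)
    case 0
    then show ?case using Q0(1) by (simp add: hd0 Q_def)
  next
    case (Suc i)
    then have i: "i < length \<gamma>" "Q i \<subset> \<gamma> ! i" by auto
    note t = tight[OF Suc.prems]
    have "\<gamma> ! Suc i \<noteq> Q i"
    proof
      assume "\<gamma> ! Suc i = Q i"
      moreover have "act (inv h) ` (- Q i) = \<gamma> ! i"
        using h by (simp add: Q_def image_act_Compl)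
      ultimately show False
        using t(1) no_tight_flip[OF half(2)[OF i(1)] inv_closed[OF h]] by simp
    qed
    moreover have "\<gamma> ! Suc i \<subseteq> Q i \<or> Q i \<subseteq> \<gamma> ! Suc i"
      using nested_tight_copy[OF half(1)[OF Suc.prems] half(1)[OF i(1)] t(1) h]
      by (rule cmp[OF Suc.prems i(1)])
    ultimately have 1: "Q i \<subset> \<gamma> ! Suc i"
      using t(1) i(2) half(2)[OF i(1)] by (auto simp: tight_sup_def)
    have "\<gamma> ! Suc i \<subseteq> Q (Suc i) \<or> Q (Suc i) \<subseteq> \<gamma> ! Suc i"
      using nested_copy[OF half(1)[OF Suc.prems] h] by (rule cmp[OF Suc.prems Suc.prems])
    moreover have "\<gamma> ! Suc i \<noteq> Q (Suc i)"
      using no_flip[OF half(1)[OF Suc.prems] h] by (simp add: Q_def)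
    ultimately show ?case
      using 1 t(2) half(1)[OF Suc.prems] by (auto simp: tight_sup_def)
  qed
  have Q_mono: "Q 0 \<subseteq> Q i" if "i < length \<gamma>" for i
    using that
  proof (induction i)
    case (Suc i)
    then show ?case using tight(2)[of i] by (auto simp: tight_sup_def)
  qed simp
  define r where "r = length \<gamma> - 1"
  have r: "r < length \<gamma>" "last \<gamma> = \<gamma> ! r"
    using ne by (simp_all add: r_def last_conv_nth)
  have g0: "act g ` hd \<gamma> \<subset> Q 0"
    using Q0(2) by (simp add: Q_def hd0)
  have hdb: "hd \<gamma> \<in> hs_between adj b (act g b)" "last \<gamma> \<in> hs_between adj b (act g b)"
    using in_b ne by auto
  \<comment> \<open>\<open>C\<close> is the candidate for extending \<gamma> at its end. It contains
    \<open>Q 0\<close>, hence \<open>g (hd \<gamma>)\<close>, so only the failure of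
    \<open>g b\<close> to lie in \<open>C\<close> can prevent the extension from being
    \<open>g\<close>-nested.\<close>
  obtain C where C: "C \<in> H" "tight_sup H (last \<gamma>) C" "Q r \<subseteq> C"
    using tight_below[OF half[OF r(1)] below[OF r(1)]] r(2) by metis
  have Cl: "C \<subset> last \<gamma>" using C(2) by (simp add: tight_sup_def)
  have "act g b \<notin> C"
  proof
    assume "act g b \<in> C"
    then have "C \<in> hs_between adj b (act g b)"
      using C(1) Cl hdb(2) by (auto simp: hs_between_def)
    moreover have "act g ` hd \<gamma> \<subset> C"
      using g0 Q_mono[OF r(1)] C(3) by blast
    ultimately have "g_nested adj act g b (\<gamma> @ [C])"
      using segment_snoc[OF seg C(1,2)] in_b ne
      by (simp add: g_nested_def seg_in_def seg_gt_def seg_copy_def hd_map hd_append)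
    then have "\<gamma> @ [C] = \<gamma>" by (rule maximal) auto
    then show False by simp
  qed
  then have gb: "act g b \<notin> Q 0"
    using C(3) Q_mono[OF r(1)] by blast
  have gH: "act g ` hd \<gamma> \<in> H"
    using half(1)[of 0] ne by (simp add: hd0 image_act_halfspace)
  have "0 < length \<gamma>" using ne by simp
  \<comment> \<open>The candidate for extending \<gamma> at its beginning is \<open>E\<close>
    translated by \<open>inv g\<close>: since \<open>g b\<close> is not in \<open>Q 0\<close>, it is
    not in \<open>E\<close>, so the translate misses \<open>b\<close>. As \<open>E\<close> is inside
    \<open>last \<gamma>\<close>, the longer segment is again \<open>g\<close>-nested.\<close>
  then obtain E where E: "E \<in> H" "tight_sup H E (act g ` hd \<gamma>)" "E \<subseteq> Q 0"
    using tight_above[OF half(2) gH g0] by metis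
  let ?E = "act (inv g) ` E"
  have EH: "?E \<in> H" "tight_sup H ?E (hd \<gamma>)"
    using image_act_halfspace[OF _ E(1)] image_act_tight[OF inv_closed[OF g] E(2)] by simp_all
  have "b \<notin> ?E"
    using gb E(3) by (auto simp: mem_image_act)
  moreover have "act g b \<in> ?E"
    using EH(2) hdb(1) by (auto simp: tight_sup_def hs_between_def)
  moreover have "E \<subset> last \<gamma>"
    using E(3) Q_mono[OF r(1)] below[OF r(1)] r(2) by auto
  ultimately have "g_nested adj act g b (?E # \<gamma>)"
    using segment_Cons[OF seg EH] in_b ne EH(1)
    by (simp add: g_nested_def seg_in_def seg_gt_def seg_copy_def hs_between_def)
  then have "?E # \<gamma> = \<gamma>" by (rule maximal) auto
  then show False by simp
qed

text \<open>The first halfspace of \<gamma>, complemented and moved by \<open>h\<close>, is strictly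
  comparable with every \<open>T i\<close> translate of \<open>hd \<gamma>\<close>. It therefore
  sits between two consecutive translates, and a power of \<open>g\<close> brings it into the gap of
  \<open>no_reverse_in_gap\<close>.\<close>

lemma no_reverse_copy:
  assumes max: "max_g_nested adj act g b \<gamma>"
    and \<sigma>: "\<sigma> \<in> copies (seg_reverse \<gamma>)" "seg_in adj \<sigma> b (T (int n) b)"
  shows False
proof -
  have seg: "segment adj \<gamma>" and in_b: "set \<gamma> \<subseteq> hs_between adj b (act g b)"
    using max by (auto simp: max_g_nested_def g_nested_def seg_in_def)
  have ne: "\<gamma> \<noteq> []" using seg by (simp add: segment_def)
  obtain h where h: "h \<in> carrier G" "\<sigma> = seg_copy act h (seg_reverse \<gamma>)"
    using \<sigma>(1) by (auto simp: copies_def)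
  have cross: "\<exists>k. crossing k (act h ` (- P))" if "P \<in> set \<gamma>" for P
  proof -
    have "act h ` (- P) \<in> hs_between adj b (T (int n) b)"
      using \<sigma>(2) h(2) that by (auto simp: seg_in_def seg_copy_def seg_reverse_def)
    then show ?thesis by (metis crossing_between)
  qed
  let ?P = "hd \<gamma>" and ?Q = "act h ` (- hd \<gamma>)"
  have P: "crossing 0 ?P" using in_b hd_in_set[OF ne] by (intro crossing_0) blast
  then have PH: "?P \<in> H" by (rule crossing_halfspace)
  obtain k where k: "crossing k ?Q" using cross[of ?P] ne by auto
  have cmp: "T i ` ?P \<subset> ?Q \<or> ?Q \<subset> T i ` ?P" for i
  proof -
    have PiH: "T i ` ?P \<in> H" using PH by (simp add: image_act_halfspace)
    have hi: "h \<otimes> inv (g [^] i) \<in> carrier G" using h(1) by simp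
    have eq: "act (h \<otimes> inv (g [^] i)) ` T i ` ?P = act h ` ?P"
      using h(1) by (simp flip: image_act_mult)
    have "nested (T i ` ?P) ?Q"
      using nested_copy[OF PiH hi] h(1) by (simp add: eq image_act_Compl nested_compl_right)
    then have "T i ` ?P \<subseteq> ?Q \<or> ?Q \<subseteq> T i ` ?P"
      using crossing_shift[OF P, of i] k crossing_comparable by blast
    moreover have "T i ` ?P \<noteq> ?Q"
      using no_flip[OF PiH hi] h(1) hi by (simp add: image_act_Compl eq)
    ultimately show ?thesis by blast
  qed
  have in_T: "T j b \<in> T i ` ?P \<longleftrightarrow> i < j" for i j
    using crossing_shift[OF P, of i] by (simp add: crossing_def)
  have in_Q: "T j b \<in> ?Q \<longleftrightarrow> k < j" for j
    using k by (simp add: crossing_def)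
  have lower: "?Q \<subset> T (k - 1) ` ?P"
  proof -
    have "T k b \<in> T (k - 1) ` ?P" "T k b \<notin> ?Q" unfolding in_T in_Q by simp_all
    then show ?thesis using cmp[of "k - 1"] by blast
  qed
  have upper: "T (k + 1) ` ?P \<subset> ?Q"
  proof -
    have "T (k + 1) b \<notin> T (k + 1) ` ?P" "T (k + 1) b \<in> ?Q" unfolding in_T in_Q by simp_all
    then show ?thesis using cmp[of "k + 1"] by blast
  qed
  \<comment> \<open>Crossing times leave only the translate of index \<open>k\<close> undecided; its
    comparison with \<open>?Q\<close> selects the gap starting at \<open>k - 1\<close> or at
    \<open>k\<close>.\<close>
  obtain i where i: "?Q \<subset> T i ` ?P" "T (i + 1) ` ?P \<subset> ?Q"
    using cmp[of k]
  proof
    assume "T k ` ?P \<subset> ?Q"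
    then have "T (k - 1 + 1) ` ?P \<subset> ?Q" by simp
    with lower show thesis by (rule that)
  next
    assume "?Q \<subset> T k ` ?P"
    then show thesis using upper by (rule that)
  qed
  let ?h = "inv (g [^] i) \<otimes> h"
  have h': "?h \<in> carrier G" using h(1) by simp
  have img: "act ?h ` A = T (- i) ` act h ` A" for A
    using h(1) by (simp add: inv_T flip: image_act_mult)
  have T: "T (- i) ` T j ` A = T (- i + j) ` A" for j A
    by (rule T_image_add)
  show False
  proof (rule no_reverse_in_gap[OF max h'])
    show "\<exists>k. crossing k (act ?h ` (- P))" if "P \<in> set \<gamma>" for P
      using cross[OF that] crossing_shift img by metis
    have "T (- i) ` ?Q \<subset> T (- i) ` T i ` ?P"
      using i(1) by (simp only: image_act_psubset[OF int_pow_closed[OF g]])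
    then show "act ?h ` (- ?P) \<subset> ?P"
      by (simp add: img T)
    have "T (- i) ` T (i + 1) ` ?P \<subset> T (- i) ` ?Q"
      using i(2) by (simp only: image_act_psubset[OF int_pow_closed[OF g]])
    then show "act g ` ?P \<subset> act ?h ` (- ?P)"
      by (simp add: img T)
  qed
qed

section \<open>Counts of copies along the orbit\<close>

lemma count_reverse:
  assumes "max_g_nested adj act g b \<gamma>"
  shows "count (seg_reverse \<gamma>) b (T (int n) b) = 0"
proof -
  obtain S where S: "packing (seg_reverse \<gamma>) b (T (int n) b) S"
    "card S = count (seg_reverse \<gamma>) b (T (int n) b)"
    by (rule count_attained)
  have "S = {}"
    using S(1) no_reverse_copy[OF assms] unfolding packing_def by blast
  with S(2) show ?thesis by simp
qed

text \<open>The translates of \<gamma> by the powers of \<open>g\<close> with exponents below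
  \<open>n\<close> form a packing, as \<open>g\<close>-nestedness makes each precede all later
  ones.\<close>

lemma count_ge:
  assumes "g_nested adj act g b \<gamma>"
  shows "n \<le> count \<gamma> b (T (int n) b)"
proof -
  have seg: "segment adj \<gamma>" and in_b: "set \<gamma> \<subseteq> hs_between adj b (act g b)"
    and gt: "act g ` hd \<gamma> \<subset> last \<gamma>"
    using assms by (auto simp: g_nested_def seg_in_def seg_gt_def seg_copy_def segment_def hd_map)
  have ne: "\<gamma> \<noteq> []" using seg by (simp add: segment_def)
  let ?c = "\<lambda>i::nat. seg_copy act (g [^] int i) \<gamma>"
  have segc: "segment adj (?c i)" for i
    using seg by (simp add: segment_copy)
  have hd_c: "hd (?c i) = T (int i) ` hd \<gamma>" "last (?c i) = T (int i) ` last \<gamma>" for i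
    using ne by (simp_all add: seg_copy_def hd_map last_map)
  have step: "T (int (Suc i)) ` hd \<gamma> \<subset> T (int i) ` last \<gamma>" for i
  proof -
    have "T (int i) ` T 1 ` hd \<gamma> \<subset> T (int i) ` last \<gamma>"
      using gt by simp
    then show ?thesis
      by (simp only: T_image_add) (simp add: add.commute)
  qed
  have last_hd: "last \<gamma> \<subseteq> hd \<gamma>"
    using segment_member_bounds(2)[OF seg] ne by simp
  have "T (int j) ` hd \<gamma> \<subset> T (int i) ` last \<gamma>" if "i < j" for i j
    using that
  proof (induction j rule: less_Suc_induct)
    case (1 i)
    show ?case by (rule step)
  next
    case (2 i j k)
    have "T (int k) ` hd \<gamma> \<subset> T (int j) ` last \<gamma>" by (rule 2(4))
    also have "\<dots> \<subseteq> T (int j) ` hd \<gamma>" using last_hd by (rule image_mono)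
    also have "\<dots> \<subset> T (int i) ` last \<gamma>" by (rule 2(3))
    finally show ?case .
  qed
  then have gt': "seg_gt (?c i) (?c j)" if "i < j" for i j
    using that by (simp add: seg_gt_def hd_c)
  have no: "\<not> overlap (?c i) (?c j)" if "i \<noteq> j" for i j
    using seg_gt_not_overlap[OF segc segc gt'] that by (metis linorder_neqE_nat)
  \<comment> \<open>A segment overlaps itself, so non-overlapping translates are distinct.\<close>
  have inj: "inj_on ?c {..<n}"
  proof (rule inj_onI, rule ccontr)
    fix i j assume "?c i = ?c j" "i \<noteq> j"
    with no[of i j] have "\<not> overlap (?c i) (?c i)" by simp
    moreover have "hd (?c i) \<in> set (?c i)"
      using ne by (intro hd_in_set) (simp add: seg_copy_def)
    ultimately show False by (auto simp: overlap_def)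
  qed
  have "packing \<gamma> b (T (int n) b) (?c ` {..<n})"
    unfolding packing_def
  proof (intro conjI)
    show "?c ` {..<n} \<subseteq> copies \<gamma>"
      by (auto simp: copies_def)
    show "\<forall>\<sigma>\<in>?c ` {..<n}. seg_in adj \<sigma> b (T (int n) b)"
    proof
      fix \<sigma> assume "\<sigma> \<in> ?c ` {..<n}"
      then obtain i where i: "i < n" "\<sigma> = ?c i" by auto
      have "T (int i) ` P \<in> hs_between adj (T 0 b) (T (int n) b)" if "P \<in> set \<gamma>" for P
      proof -
        have "crossing (int i) (T (int i) ` P)"
          using crossing_shift[OF crossing_0, of P "int i"] in_b that by auto
        then show ?thesis
          using i(1) by (simp only: crossing_between_iff) simp
      qed
      then show "seg_in adj \<sigma> b (T (int n) b)"
        using i(2) by (auto simp: seg_in_def seg_copy_def)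
    qed
    show "\<forall>\<sigma>\<in>?c ` {..<n}. \<forall>\<tau>\<in>?c ` {..<n}. \<sigma> \<noteq> \<tau> \<longrightarrow> \<not> overlap \<sigma> \<tau>"
    proof (intro ballI impI)
      fix \<sigma> \<tau> assume "\<sigma> \<in> ?c ` {..<n}" "\<tau> \<in> ?c ` {..<n}" "\<sigma> \<noteq> \<tau>"
      then obtain i j where ij: "\<sigma> = ?c i" "\<tau> = ?c j" by blast
      with \<open>\<sigma> \<noteq> \<tau>\<close> have "i \<noteq> j" by blast
      from no[OF this] show "\<not> overlap \<sigma> \<tau>" unfolding ij .
    qed
  qed simp
  from packing_le_count[OF this] show ?thesis
    using inj by (simp add: card_image)
qed

text \<open>Translation identifies the second stretch of the orbit with an initial one. A hyperplane
  crossed on either stretch is not crossed back, which supplies the inclusions for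
  \<open>count_superadditive\<close>.\<close>

lemma count_quasi_additive:
  assumes "segment adj \<gamma>"
  shows "\<bar>real (count \<gamma> b (T (int (m + n)) b)) - real (count \<gamma> b (T (int m) b))
    - real (count \<gamma> b (T (int n) b))\<bar> \<le> 1"
proof -
  have shift: "count \<gamma> (T (int m) b) (T (int (m + n)) b) = count \<gamma> b (T (int n) b)"
    using count_act[of "g [^] int m" \<gamma> b "T (int n) b"] by (simp add: T_add)
  have "hs_between adj b (T (int m) b) \<subseteq> hs_between adj b (T (int (m + n)) b)"
  proof
    fix P assume P: "P \<in> hs_between adj b (T (int m) b)"
    then obtain k where k: "0 \<le> k" "k < int m" "crossing k P" by (rule crossing_between)
    then show "P \<in> hs_between adj b (T (int (m + n)) b)"
      using crossing_between_iff[OF k(3), of 0 "int (m + n)"] by simp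
  qed
  moreover have "hs_between adj (T (int m) b) (T (int (m + n)) b) \<subseteq> hs_between adj b (T (int (m + n)) b)"
  proof
    fix P assume "P \<in> hs_between adj (T (int m) b) (T (int (m + n)) b)"
    then have "T (- int m) ` P \<in> hs_between adj (T (- int m) (T (int m) b)) (T (- int m) (T (int (m + n)) b))"
      by (rule image_act_between[OF int_pow_closed[OF g]])
    then have "T (- int m) ` P \<in> hs_between adj b (T (int n) b)"
      by (simp add: T_add)
    then obtain k where k: "0 \<le> k" "k < int n" "crossing k (T (- int m) ` P)"
      by (rule crossing_between)
    have "crossing (k + int m) P"
      using crossing_shift[OF k(3), of "int m"] by (simp add: T_image_add)
    then show "P \<in> hs_between adj b (T (int (m + n)) b)"
      using k crossing_between_iff[of "k + int m" P 0 "int (m + n)"] by simp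
  qed
  ultimately show ?thesis
    using count_superadditive[OF assms, of b "T (int m) b" "T (int (m + n)) b"]
      count_subadditive[OF assms, of b "T (int (m + n)) b" "T (int m) b"]
    unfolding shift by linarith
qed

end

theorem theorem5p6:
  fixes G :: "('g, 'm) monoid_scheme" and adj :: "'v \<Rightarrow> 'v \<Rightarrow> bool"
    and act :: "'g \<Rightarrow> 'v \<Rightarrow> 'v" and g :: 'g and b :: 'v and \<gamma> :: "'v set list"
  assumes "median_graph adj"
    and "cube_action G adj act"
    and "raag_like G adj act"
    and "g \<in> carrier G"
    and "hyperbolic adj act g"
    and "dc adj b (act g b) = translation_length adj act g"
    and "max_g_nested adj act g b \<gamma>"
  shows "\<exists>L. (\<lambda>n::nat. real_of_int (omega G adj act \<gamma> b (act (g [^]\<^bsub>G\<^esub> n) b)) / real n) \<longlonglongrightarrow> L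
             \<and> L \<ge> 1"
proof -
  interpret raag_axis adj G act g b
  proof unfold_locales
    show "dc adj b (act g b) \<le> dc adj x (act g x)" for x
      unfolding assms(6) translation_length_def by (rule Least_le) blast
  qed (use assms in auto)
  define a where "a n = real (count \<gamma> b (T (int n) b))" for n
  have nested: "g_nested adj act g b \<gamma>"
    using assms(7) by (simp add: max_g_nested_def)
  then have "convergent (\<lambda>n. a n / real n)"
    unfolding a_def by (intro quasi_additive_convergent[of _ 1] count_quasi_additive)
      (simp add: g_nested_def)
  then obtain L where L: "(\<lambda>n. a n / real n) \<longlonglongrightarrow> L"
    by (auto simp: convergent_def)
  \<comment> \<open>At \<open>n = 0\<close> the quotient is 0 by the convention for division by
    zero, so the bound starts at 1.\<close>
  have "a n / real n \<ge> 1" if "n \<ge> 1" for n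
    using count_ge[OF nested, of n] that by (simp add: a_def)
  then have "L \<ge> 1"
    by (intro LIMSEQ_le_const[OF L]) blast
  \<comment> \<open>The reverse count vanishes along the orbit, so \<open>omega\<close> is the plain
    count.\<close>
  moreover have "real_of_int (omega G adj act \<gamma> b (act (g [^]\<^bsub>G\<^esub> n) b)) = a n" for n
    using count_reverse[OF assms(7), of n] by (simp add: omega_def a_def int_pow_int)
  ultimately show ?thesis
    using L by auto
qed

end
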